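(* Let $A$ be a subset of $X$, where $(\mathcal{B},\nu)$ is an effective topology on $X$. (1) If $A$ is open, then $A$ has a basic representation in $(\mathcal{B},\nu)$. (2) If $A$ is closed, then $A$ has a basic representation in $(\mathcal{B},\nu)$.
   Context: An effective topology $(\mathcal{B},\nu)$ on a set $X$ consists of a countable basis $\mathcal{B}$ for a $T_0$ topology on $X$ and a coding $\nu$: a (not necessarily injective) assignment $n\mapsto\nu(n)$ of basis elements to non-negative integers under which every basis element is coded; $\mathrm{dom}_{\mathcal{B}}\nu$ is the set of $n$ with $\nu(n)\in\mathcal{B}$. A set $\mathcal{L}_x\subseteq\mathcal{B}$ is a local basis for $x\in X$ iff every member contains $x$ and every $B\in\mathcal{B}$ containing $x$ has a subset in $\mathcal{L}_x$. A set $R$ of non-negative integers is a basic representation of $A\subseteq X$ in $(\mathcal{B},\nu)$ iff (i) $R\subseteq\mathrm{dom}_{\mathcal{B}}\nu$ and (ii) for every $x\in X$: $x\in A$ iff there exists a local basis $\mathcal{L}_x$ for $x$ with $\mathcal{L}_x\subseteq\{\nu(r):r\in R\}$. *)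

theory Defs
  imports "HOL-Analysis.Analysis"
begin

definition basis_in :: "'a topology \<Rightarrow> 'a set set \<Rightarrow> bool" where
  "basis_in T \<B> \<longleftrightarrow> openin T = arbitrary union_of (\<lambda>U. U \<in> \<B>)"

(* A coding is a partial function that need not be injective. It may also take values
   outside the basis; such codes are excluded by coding_dom below. *)
definition effective_topology ::
  "'a set \<Rightarrow> 'a topology \<Rightarrow> 'a set set \<Rightarrow> (nat \<rightharpoonup> 'a set) \<Rightarrow> bool" where
  "effective_topology X T \<B> \<nu> \<longleftrightarrow>
     topspace T = X \<and> t0_space T \<and> countable \<B> \<and> basis_in T \<B> \<and> \<B> \<subseteq> ran \<nu>"

definition coding_dom :: "'a set set \<Rightarrow> (nat \<rightharpoonup> 'a set) \<Rightarrow> nat set" where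
  "coding_dom \<B> \<nu> = {n. \<exists>U\<in>\<B>. \<nu> n = Some U}"

definition local_basis :: "'a set set \<Rightarrow> 'a \<Rightarrow> 'a set set \<Rightarrow> bool" where
  "local_basis \<B> x L \<longleftrightarrow>
     L \<subseteq> \<B> \<and> (\<forall>U\<in>L. x \<in> U) \<and> (\<forall>B\<in>\<B>. x \<in> B \<longrightarrow> (\<exists>U\<in>L. U \<subseteq> B))"

definition basic_representation ::
  "'a set \<Rightarrow> 'a set set \<Rightarrow> (nat \<rightharpoonup> 'a set) \<Rightarrow> nat set \<Rightarrow> 'a set \<Rightarrow> bool" where
  "basic_representation X \<B> \<nu> R A \<longleftrightarrow>
     R \<subseteq> coding_dom \<B> \<nu> \<and>
     (\<forall>x\<in>X. x \<in> A \<longleftrightarrow> (\<exists>L. local_basis \<B> x L \<and> L \<subseteq> {U. \<exists>r\<in>R. \<nu> r = Some U}))"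

end

(* An open set is represented by the basis elements contained in it, a closed set by the
   basis elements that meet it. *)
theory Submission
  imports Defs
begin

text \<open>For any subfamily \<open>\<C>\<close> of the basis, the set of all codes of members of
  \<open>\<C>\<close> represents exactly those points x at which \<open>\<C>\<close> has arbitrarily
  small members: every basis element around x includes a member of \<open>\<C>\<close> that contains
  x. This is \<open>basic_representation_of_subfamily\<close>, and it leaves only the choice of
  \<open>\<C>\<close>. For open A, a basis element B around a point of A can be shrunk into the open
  set A \<inter> B, while a member of \<open>\<C>\<close> around x already puts x in A. For closed
  A, a basis element around a point of A meets A there, while a point outside A has a basis element
  around it that misses A.\<close>

lemma basis_in_open:
  assumes "basis_in T \<B>" "B \<in> \<B>"
  shows "openin T B"
  using assms by (simp add: basis_in_def union_of_inc arbitrary_def)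

lemma basis_in_nbhd:
  assumes "basis_in T \<B>" "openin T V" "x \<in> V"
  obtains B where "B \<in> \<B>" "x \<in> B" "B \<subseteq> V"
  using assms unfolding basis_in_def union_of_def arbitrary_def by auto

text \<open>Enlarging a local basis within \<open>\<C>\<close> by further members of
  \<open>\<C>\<close> around x keeps it a local basis. So the existential over local bases can be
  tested on a single candidate, which turns it into the condition on \<open>\<C>\<close> in the
  hypothesis \<open>iff\<close>.\<close>

lemma basic_representation_of_subfamily:
  assumes "\<B> \<subseteq> ran \<nu>" "\<C> \<subseteq> \<B>"
    and iff: "\<And>x. x \<in> X \<Longrightarrow> x \<in> A \<longleftrightarrow> (\<forall>B\<in>\<B>. x \<in> B \<longrightarrow> (\<exists>U\<in>\<C>. x \<in> U \<and> U \<subseteq> B))"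
  shows "basic_representation X \<B> \<nu> {n. \<exists>U\<in>\<C>. \<nu> n = Some U} A"
proof -
  \<comment> \<open>Every basis element has a code, so decoding all codes of members of
    \<open>\<C>\<close> loses nothing.\<close>
  have codes: "{U. \<exists>r\<in>{n. \<exists>U\<in>\<C>. \<nu> n = Some U}. \<nu> r = Some U} = \<C>"
    using assms(1,2) by (fastforce simp: ran_def)
  have "(\<exists>L. local_basis \<B> x L \<and> L \<subseteq> \<C>) \<longleftrightarrow>
        (\<forall>B\<in>\<B>. x \<in> B \<longrightarrow> (\<exists>U\<in>\<C>. x \<in> U \<and> U \<subseteq> B))" for x
  proof
    assume "\<exists>L. local_basis \<B> x L \<and> L \<subseteq> \<C>"
    then show "\<forall>B\<in>\<B>. x \<in> B \<longrightarrow> (\<exists>U\<in>\<C>. x \<in> U \<and> U \<subseteq> B)"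
      unfolding local_basis_def by blast
  next
    assume "\<forall>B\<in>\<B>. x \<in> B \<longrightarrow> (\<exists>U\<in>\<C>. x \<in> U \<and> U \<subseteq> B)"
    \<comment> \<open>The largest candidate: all members of \<open>\<C>\<close> around x.\<close>
    then have "local_basis \<B> x {U\<in>\<C>. x \<in> U}"
      using assms(2) unfolding local_basis_def by blast
    then show "\<exists>L. local_basis \<B> x L \<and> L \<subseteq> \<C>"
      by blast
  qed
  then show ?thesis
    using assms(2) iff unfolding basic_representation_def codes
    by (auto simp: coding_dom_def)
qed

theorem theorem10:
  fixes X :: "'a set" and T :: "'a topology" and \<B> :: "'a set set"
    and \<nu> :: "nat \<rightharpoonup> 'a set" and A :: "'a set"
  assumes "effective_topology X T \<B> \<nu>"
    and "A \<subseteq> X"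
  shows "(openin T A \<longrightarrow> (\<exists>R. basic_representation X \<B> \<nu> R A)) \<and>
         (closedin T A \<longrightarrow> (\<exists>R. basic_representation X \<B> \<nu> R A))"
proof -
  have X: "topspace T = X" and basis: "basis_in T \<B>" and coded: "\<B> \<subseteq> ran \<nu>"
    using assms(1) by (auto simp: effective_topology_def)
  have "\<exists>R. basic_representation X \<B> \<nu> R A" if A: "openin T A"
  proof -
    have "x \<in> A \<longleftrightarrow> (\<forall>B\<in>\<B>. x \<in> B \<longrightarrow> (\<exists>U\<in>{U\<in>\<B>. U \<subseteq> A}. x \<in> U \<and> U \<subseteq> B))"
      if "x \<in> X" for x
    proof (intro iffI ballI impI)
      fix B assume "x \<in> A" "B \<in> \<B>" "x \<in> B"
      then have "openin T (A \<inter> B)" "x \<in> A \<inter> B"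
        using A basis_in_open[OF basis] by auto
      then obtain U where "U \<in> \<B>" "x \<in> U" "U \<subseteq> A \<inter> B"
        by (rule basis_in_nbhd[OF basis])
      then show "\<exists>U\<in>{U\<in>\<B>. U \<subseteq> A}. x \<in> U \<and> U \<subseteq> B" by blast
    next
      assume *: "\<forall>B\<in>\<B>. x \<in> B \<longrightarrow> (\<exists>U\<in>{U\<in>\<B>. U \<subseteq> A}. x \<in> U \<and> U \<subseteq> B)"
      \<comment> \<open>The assumption \<open>*\<close> says something about x only if some basis
        element contains x; the open set X provides one.\<close>
      have "openin T X"
        using openin_topspace[of T] X by simp
      then obtain B where "B \<in> \<B>" "x \<in> B" "B \<subseteq> X"
        using \<open>x \<in> X\<close> by (rule basis_in_nbhd[OF basis])
      with * show "x \<in> A" by blast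
    qed
    then show "\<exists>R. basic_representation X \<B> \<nu> R A"
      using basic_representation_of_subfamily[OF coded, of "{U\<in>\<B>. U \<subseteq> A}" X A] by blast
  qed
  moreover have "\<exists>R. basic_representation X \<B> \<nu> R A" if A: "closedin T A"
  proof -
    have "x \<in> A \<longleftrightarrow> (\<forall>B\<in>\<B>. x \<in> B \<longrightarrow> (\<exists>U\<in>{U\<in>\<B>. U \<inter> A \<noteq> {}}. x \<in> U \<and> U \<subseteq> B))"
      if "x \<in> X" for x
    proof
      assume *: "\<forall>B\<in>\<B>. x \<in> B \<longrightarrow> (\<exists>U\<in>{U\<in>\<B>. U \<inter> A \<noteq> {}}. x \<in> U \<and> U \<subseteq> B)"
      show "x \<in> A"
      proof (rule ccontr)
        assume "x \<notin> A"
        then have "openin T (X - A)" "x \<in> X - A"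
          using A X that by (auto simp: closedin_def)
        then obtain B where "B \<in> \<B>" "x \<in> B" "B \<subseteq> X - A"
          by (rule basis_in_nbhd[OF basis])
        \<comment> \<open>By \<open>*\<close>, some subset of B meets A, but B misses A.\<close>
        with * show False by blast
      qed
    \<comment> \<open>For x in A the witness is B itself, since it meets A at x.\<close>
    qed blast
    then show "\<exists>R. basic_representation X \<B> \<nu> R A"
      using basic_representation_of_subfamily[OF coded, of "{U\<in>\<B>. U \<inter> A \<noteq> {}}" X A] by blast
  qed
  ultimately show ?thesis by blast
qed

end
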